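(* Let $G=(V,E)$ be a finite, connected graph with $n=|V|$, and let $\mathbf{P}$ be an $\mathrm{Aut}(G)$-invariant probability measure on $\{0,1\}^E$ supported on the set of spanning trees of $G$, with expectation $\mathbf{E}$. Then $$\sum_{e\sim f}\mathbf{P}\big[\omega(e)=\omega(f)=1\big]=\sum_{x\in V}\mathbf{E}\big[\deg(x;\omega)^2\big]-2(n-1),$$ where the sum on the left-hand side runs over all ordered pairs of distinct adjacent edges $e,f$ of $G$; and $$\sum_{e\not\sim f}\mathbf{P}\big[\omega(e)=\omega(f)=1\big]=n(n-1)-\sum_{x\in V}\mathbf{E}\big[\deg(x;\omega)^2\big],$$ where the sum on the left-hand side runs over all ordered pairs of non-adjacent edges $e,f$ of $G$.
   Context: An element $\omega\in\{0,1\}^E$ is identified with the subgraph $(V,\eta(\omega))$, where $\eta(\omega)=\{e\in E:\omega(e)=1\}$; "supported on the set of spanning trees" means that $(V,\eta(\omega))$ is $\mathbf{P}$-almost surely a spanning tree of $G$. $\deg(x;\omega)$ is the degree of $x$ in $(V,\eta(\omega))$. Two distinct edges $e,f$ are adjacent, written $e\sim f$, if they share a common endpoint; two distinct edges are non-adjacent, written $e\not\sim f$, if they share no endpoint. $\mathrm{Aut}(G)$ is the group of graph automorphisms of $G$. *)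

theory Defs
  imports "HOL-Probability.Probability"
begin

(* Graphs are undirected and simple: an edge is a two-element set of vertices. *)

definition simple_graph :: "'v set \<Rightarrow> 'v set set \<Rightarrow> bool" where
  "simple_graph V E \<longleftrightarrow> (\<forall>e\<in>E. e \<subseteq> V \<and> card e = 2)"

(* The graph without vertices does not count as connected. *)
definition connected_graph :: "'v set \<Rightarrow> 'v set set \<Rightarrow> bool" where
  "connected_graph V E \<longleftrightarrow>
     V \<noteq> {} \<and> (\<forall>x\<in>V. \<forall>y\<in>V. (x, y) \<in> {(u, v). {u, v} \<in> E}\<^sup>*)"

(* A cycle is listed by its pairwise distinct vertices, without repeating the first one. *)
definition graph_cycle :: "'v set set \<Rightarrow> 'v list \<Rightarrow> bool" where
  "graph_cycle E xs \<longleftrightarrow>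
     3 \<le> length xs \<and> distinct xs \<and>
     (\<forall>i<length xs. {xs ! i, xs ! (Suc i mod length xs)} \<in> E)"

definition tree_graph :: "'v set \<Rightarrow> 'v set set \<Rightarrow> bool" where
  "tree_graph V E \<longleftrightarrow>
     simple_graph V E \<and> connected_graph V E \<and> (\<nexists>xs. graph_cycle E xs)"

definition graph_degree :: "'v set set \<Rightarrow> 'v \<Rightarrow> nat" where
  "graph_degree E x = card {e \<in> E. x \<in> e}"

definition adjacent_edges :: "'v set \<Rightarrow> 'v set \<Rightarrow> bool" where
  "adjacent_edges e f \<longleftrightarrow> e \<noteq> f \<and> e \<inter> f \<noteq> {}"

definition nonadjacent_edges :: "'v set \<Rightarrow> 'v set \<Rightarrow> bool" where
  "nonadjacent_edges e f \<longleftrightarrow> e \<noteq> f \<and> e \<inter> f = {}"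

(* Only the values of an automorphism on V matter. Singletons are never edges of a simple
   graph, so the pairs with x = y impose nothing. *)
definition graph_automorphism :: "'v set \<Rightarrow> 'v set set \<Rightarrow> ('v \<Rightarrow> 'v) \<Rightarrow> bool" where
  "graph_automorphism V E \<phi> \<longleftrightarrow>
     bij_betw \<phi> V V \<and> (\<forall>x\<in>V. \<forall>y\<in>V. {\<phi> x, \<phi> y} \<in> E \<longleftrightarrow> {x, y} \<in> E)"

(* The space {0,1}^E with the product of the discrete sigma-algebras. Its points are the
   functions E -> {0,1}, extended by the value undefined outside E. *)
definition config_space :: "'v set set \<Rightarrow> ('v set \<Rightarrow> nat) measure" where
  "config_space E = (\<Pi>\<^sub>M e\<in>E. count_space {0, 1})"

definition open_edges :: "'v set set \<Rightarrow> ('v set \<Rightarrow> nat) \<Rightarrow> 'v set set" where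
  "open_edges E \<omega> = {e \<in> E. \<omega> e = 1}"

(* The left action (phi omega)(e) = omega(phi^{-1} e), under which the open edges of
   phi omega are the images under phi of those of omega. *)
definition config_action ::
    "'v set \<Rightarrow> 'v set set \<Rightarrow> ('v \<Rightarrow> 'v) \<Rightarrow> ('v set \<Rightarrow> nat) \<Rightarrow> ('v set \<Rightarrow> nat)" where
  "config_action V E \<phi> \<omega> = (\<lambda>e\<in>E. \<omega> (inv_into V \<phi> ` e))"

definition aut_invariant :: "'v set \<Rightarrow> 'v set set \<Rightarrow> ('v set \<Rightarrow> nat) measure \<Rightarrow> bool" where
  "aut_invariant V E P \<longleftrightarrow>
     (\<forall>\<phi>. graph_automorphism V E \<phi> \<longrightarrow> distr P P (config_action V E \<phi>) = P)"

end

theory Submission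
  imports Defs
begin

text \<open>
  Put $p(e,f) = \mathbf{P}[\omega(e)=\omega(f)=1]$. Expanding the squared degree gives
  $\sum_x \mathbf{E}[\deg(x)^2] = \sum_{e,f} |e \cap f|\, p(e,f)$, where $|e \cap f|$ is
  2 on the diagonal, 1 for adjacent and 0 for non-adjacent edges. A spanning tree has
  $n-1$ edges, so $\sum_e p(e,e) = n-1$ and $\sum_{e,f} p(e,f) = (n-1)^2$. The two identities
  follow by linear algebra. Trees have $n-1$ edges because each edge added to a
  forest merges two connected components.
\<close>

section \<open>Reachability and connected components\<close>

definition edge_rel :: "'v set set \<Rightarrow> ('v \<times> 'v) set" where
  "edge_rel E = {(u, v). {u, v} \<in> E}"

text \<open>The connected component of \<open>x\<close>. The vertex set is left out because it stays
  fixed while edges are added; the components of a graph on \<open>V\<close> are the values of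
  \<open>reachable E\<close> on \<open>V\<close>.\<close>

definition reachable :: "'v set set \<Rightarrow> 'v \<Rightarrow> 'v set" where
  "reachable E x = (edge_rel E)\<^sup>* `` {x}"

lemma edge_rel_insert: "edge_rel (insert {u, v} E) = insert (u, v) (insert (v, u) (edge_rel E))"
  by (auto simp: edge_rel_def doubleton_eq_iff)

lemma reachable_refl [simp]: "x \<in> reachable E x"
  by (simp add: reachable_def)

lemma reachable_sym: "y \<in> reachable E x \<Longrightarrow> x \<in> reachable E y"
proof -
  have "sym (edge_rel E)"
    by (auto simp: edge_rel_def sym_def insert_commute)
  then show "y \<in> reachable E x \<Longrightarrow> x \<in> reachable E y"
    by (auto simp: reachable_def dest: sym_rtrancl symD)
qed

lemma reachable_trans: "y \<in> reachable E x \<Longrightarrow> z \<in> reachable E y \<Longrightarrow> z \<in> reachable E x"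
  by (auto simp: reachable_def)

lemma reachable_eq: "y \<in> reachable E x \<Longrightarrow> reachable E y = reachable E x"
  by (meson reachable_sym reachable_trans subset_antisym subsetI)

text \<open>A new edge merges the components of its ends and leaves the others alone. If both ends
  already lie in one component, the union is that component, so no case distinction is
  needed.\<close>

lemma reachable_insert:
  "reachable (insert {u, v} E) x =
     (if x \<in> reachable E u \<union> reachable E v then reachable E u \<union> reachable E v
      else reachable E x)"
proof -
  \<comment> \<open>A walk needs the new edge at most once, in one of its two directions: crossing
    it back and forth ends in the component where the walk started.\<close>
  have "y \<in> reachable (insert {u, v} E) x \<longleftrightarrow>
      y \<in> reachable E x \<or> (u \<in> reachable E x \<and> y \<in> reachable E v)
      \<or> (v \<in> reachable E x \<and> y \<in> reachable E u)" for y
    unfolding reachable_def edge_rel_insert rtrancl_insert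
    by (auto intro: rtrancl_trans)
  moreover have "w \<in> reachable E x \<longleftrightarrow> x \<in> reachable E w" for w
    using reachable_sym by metis
  ultimately show ?thesis
    using reachable_eq[of x E u] reachable_eq[of x E v] by (auto simp del: reachable_refl)
qed

section \<open>Distinct paths and cycles\<close>

lemma distinct_path_exists:
  assumes "y \<in> reachable E x"
  shows "\<exists>xs. xs \<noteq> [] \<and> hd xs = x \<and> last xs = y \<and> distinct xs \<and>
    successively (\<lambda>a b. {a, b} \<in> E) xs"
proof -
  have "(x, y) \<in> (edge_rel E)\<^sup>*"
    using assms by (simp add: reachable_def)
  then show ?thesis
  proof (induction rule: rtrancl_induct)
    case base
    show ?case by (rule exI[of _ "[x]"]) simp
  next
    case (step y z)
    then obtain xs where xs: "xs \<noteq> []" "hd xs = x" "last xs = y" "distinct xs"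
        "successively (\<lambda>a b. {a, b} \<in> E) xs"
      by blast
    show ?case
    \<comment> \<open>If the path already visits \<open>z\<close>, it is cut off there; otherwise
      \<open>z\<close> is appended.\<close>
    proof (cases "z \<in> set xs")
      case True
      then obtain ys zs where "xs = ys @ z # zs"
        by (meson split_list)
      with xs show ?thesis
        by (intro exI[of _ "ys @ [z]"]) (auto simp: successively_append_iff hd_append)
    next
      case False
      with xs step show ?thesis
        by (intro exI[of _ "xs @ [z]"])
           (auto simp: successively_append_iff hd_append edge_rel_def)
    qed
  qed
qed

text \<open>The new edge closes a distinct path from \<open>u\<close> to \<open>v\<close> into a
  cycle.\<close>

lemma graph_cycle_insert:
  assumes "v \<in> reachable E u" "u \<noteq> v" "{u, v} \<notin> E"
  shows "\<exists>xs. graph_cycle (insert {u, v} E) xs"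
proof -
  obtain xs where xs: "xs \<noteq> []" "hd xs = u" "last xs = v" "distinct xs"
      and suc: "successively (\<lambda>a b. {a, b} \<in> E) xs"
    using distinct_path_exists[OF assms(1)] by blast
  \<comment> \<open>A path with one vertex would force \<open>u = v\<close>, and one with two
    vertices would be the edge \<open>{u, v}\<close> of \<open>E\<close>.\<close>
  have "length xs \<noteq> 1"
    using xs assms(2) by (cases xs) auto
  moreover have "length xs \<noteq> 2"
    using xs suc assms(3) by (auto simp: length_Suc_conv numeral_2_eq_2)
  ultimately have len: "3 \<le> length xs"
    using xs(1) length_0_conv[of xs] by linarith
  have "{xs ! i, xs ! (Suc i mod length xs)} \<in> insert {u, v} E" if i: "i < length xs" for i
  proof (cases "Suc i = length xs")
    \<comment> \<open>The index wraps around to 0 here, which gives the closing edge.\<close>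
    case True
    then have "xs ! i = v" "xs ! (Suc i mod length xs) = u"
      using xs by (auto simp: last_conv_nth hd_conv_nth simp flip: True)
    then show ?thesis by auto
  next
    case False
    then show ?thesis
      using i suc by (auto simp: successively_conv_nth)
  qed
  then show ?thesis
    using len xs(4) unfolding graph_cycle_def by blast
qed

section \<open>Edge counts of forests and trees\<close>

lemma graph_cycle_mono: "graph_cycle E xs \<Longrightarrow> E \<subseteq> F \<Longrightarrow> graph_cycle F xs"
  by (auto simp: graph_cycle_def)

text \<open>Without edges every vertex is its own component. Each further edge lowers the number of
  components by exactly one, since an edge inside a component would close a cycle.\<close>

lemma forest_card_components:
  fixes V :: "'v set" and E :: "'v set set"
  assumes "finite V" "finite E" "simple_graph V E" "\<nexists>xs. graph_cycle E xs"
  shows "card (reachable E ` V) + card E = card V"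
  using assms(2-4)
proof (induction E rule: finite_induct)
  case empty
  have "reachable {} x = {x}" for x :: 'v
    by (simp add: reachable_def edge_rel_def)
  then show ?case
    by (simp add: card_image inj_on_def)
next
  case (insert e E)
  obtain u v where e: "e = {u, v}" "u \<noteq> v" "u \<in> V" "v \<in> V"
    using insert.prems(1) by (auto simp: simple_graph_def card_2_iff)
  have IH: "card (reachable E ` V) + card E = card V"
    using insert.IH insert.prems graph_cycle_mono[of E _ "insert e E"]
    by (auto simp: simple_graph_def)
  have sep: "v \<notin> reachable E u"
    using graph_cycle_insert[of v E u] insert.prems(2) insert.hyps(2) e by auto
  then have ne: "reachable E u \<noteq> reachable E v"
    using reachable_refl[of v E] by auto
  let ?C = "reachable E ` V" and ?U = "reachable E u \<union> reachable E v"
  \<comment> \<open>Two components are replaced by their union.\<close>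
  have "reachable (insert e E) ` V = insert ?U (?C - {reachable E u, reachable E v})"
  proof (intro equalityI subsetI)
    fix A assume "A \<in> reachable (insert e E) ` V"
    then obtain x where x: "x \<in> V" "A = reachable (insert {u, v} E) x"
      using e by auto
    show "A \<in> insert ?U (?C - {reachable E u, reachable E v})"
    proof (cases "x \<in> ?U")
      case True
      then show ?thesis using x by (simp add: reachable_insert)
    next
      case False
      then have "A = reachable E x"
        using x by (simp add: reachable_insert)
      moreover have "reachable E x \<noteq> reachable E u" "reachable E x \<noteq> reachable E v"
        using False reachable_refl[of x E] by blast+
      ultimately show ?thesis using x by blast
    qed
  next
    fix A assume A: "A \<in> insert ?U (?C - {reachable E u, reachable E v})"
    show "A \<in> reachable (insert e E) ` V"
    proof (cases "A = ?U")
      case True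
      then have "A = reachable (insert e E) u"
        by (simp add: e reachable_insert)
      then show ?thesis using e by blast
    next
      case False
      with A obtain x where x: "x \<in> V" "A = reachable E x"
          "A \<noteq> reachable E u" "A \<noteq> reachable E v"
        by auto
      then have "x \<notin> ?U"
        using reachable_eq[of x E u] reachable_eq[of x E v] by blast
      then have "A = reachable (insert e E) x"
        using x(2) by (simp add: e reachable_insert)
      then show ?thesis using x by blast
    qed
  qed
  \<comment> \<open>The union is a new element, so the count changes by -2 + 1. The bound
    \<open>2 \<le> card ?C\<close> below keeps the subtraction in the naturals exact.\<close>
  moreover have "?U \<notin> ?C"
  proof
    assume "?U \<in> ?C"
    then obtain x where x: "reachable E x = ?U" by auto
    have "u \<in> reachable E x" "v \<in> reachable E x"
      unfolding x by simp_all
    then show False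
      using reachable_eq[of u E x] reachable_eq[of v E x] ne by simp
  qed
  moreover have "card (?C - {reachable E u, reachable E v}) = card ?C - 2"
    using e ne by (subst card_Diff_subset) auto
  moreover have "2 \<le> card ?C"
    using card_mono[of ?C "{reachable E u, reachable E v}"] assms(1) e ne by auto
  ultimately show ?case
    using IH insert.hyps assms(1) by simp
qed

lemma tree_card_edges:
  assumes "finite V" "tree_graph V E"
  shows "card E + 1 = card V"
proof -
  have simple: "simple_graph V E" and acyclic: "\<nexists>xs. graph_cycle E xs"
      and connected: "connected_graph V E"
    using assms(2) unfolding tree_graph_def by blast+
  have "E \<subseteq> Pow V"
    using simple by (auto simp: simple_graph_def)
  then have "finite E"
    using assms(1) by (meson finite_Pow_iff finite_subset)
  then have "card (reachable E ` V) + card E = card V"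
    by (intro forest_card_components assms(1) simple acyclic)
  moreover obtain r where r: "r \<in> V"
    using connected unfolding connected_graph_def by blast
  \<comment> \<open>Connectedness leaves the single component of \<open>r\<close>.\<close>
  have "reachable E x \<in> {reachable E r}" if "x \<in> V" for x
  proof -
    have "x \<in> reachable E r"
      using connected r that
      unfolding connected_graph_def reachable_def edge_rel_def Image_singleton_iff by blast
    then show ?thesis
      using reachable_eq[of x E r] by simp
  qed
  then have "reachable E ` V \<subseteq> {reachable E r}"
    by (rule image_subsetI)
  then have "reachable E ` V = {reachable E r}"
    using r by blast
  ultimately show ?thesis by simp
qed

section \<open>Sums of probabilities as expected counts\<close>

lemma (in prob_space) sum_prob_eq_expectation_card:
  assumes "finite S" "\<And>s. s \<in> S \<Longrightarrow> {\<omega> \<in> space M. Q s \<omega>} \<in> events"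
  shows "(\<Sum>s\<in>S. \<P>(\<omega> in M. Q s \<omega>)) = (\<integral>\<omega>. real (card {s \<in> S. Q s \<omega>}) \<partial>M)"
proof -
  have "(\<Sum>s\<in>S. \<P>(\<omega> in M. Q s \<omega>))
      = (\<Sum>s\<in>S. \<integral>\<omega>. indicator {\<omega> \<in> space M. Q s \<omega>} \<omega> \<partial>M)"
    using assms(2) by (intro sum.cong) (auto simp: measure_def)
  also have "\<dots> = (\<integral>\<omega>. (\<Sum>s\<in>S. indicator {\<omega> \<in> space M. Q s \<omega>} \<omega>) \<partial>M)"
    using assms(2) by (intro Bochner_Integration.integral_sum[symmetric])
      (auto simp: emeasure_eq_measure)
  also have "\<dots> = (\<integral>\<omega>. real (card {s \<in> S. Q s \<omega>}) \<partial>M)"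
    using assms(1) by (intro Bochner_Integration.integral_cong refl)
      (simp add: indicator_def sum.If_cases Int_def)
  finally show ?thesis .
qed

lemma (in prob_space) sum_prob_eq_const:
  assumes "finite S" "\<And>s. s \<in> S \<Longrightarrow> {\<omega> \<in> space M. Q s \<omega>} \<in> events"
    and "AE \<omega> in M. card {s \<in> S. Q s \<omega>} = c"
  shows "(\<Sum>s\<in>S. \<P>(\<omega> in M. Q s \<omega>)) = real c"
proof -
  \<comment> \<open>An almost sure equality transfers to integrals only for measurable functions;
    the count inherits measurability from this sum of indicators.\<close>
  have "(\<lambda>\<omega>. \<Sum>s\<in>S. indicator {\<omega> \<in> space M. Q s \<omega>} \<omega> :: real) \<in> borel_measurable M"
    using assms(2) by measurable
  moreover have "(\<Sum>s\<in>S. indicator {\<omega> \<in> space M. Q s \<omega>} \<omega>) = real (card {s \<in> S. Q s \<omega>})"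
    if "\<omega> \<in> space M" for \<omega>
    using assms(1) that by (simp add: indicator_def sum.If_cases Int_def)
  ultimately have "(\<lambda>\<omega>. real (card {s \<in> S. Q s \<omega>})) \<in> borel_measurable M"
    by (simp cong: measurable_cong)
  then have "(\<integral>\<omega>. real (card {s \<in> S. Q s \<omega>}) \<partial>M) = (\<integral>\<omega>. real c \<partial>M)"
    using assms(3) by (intro integral_cong_AE) auto
  then show ?thesis
    using sum_prob_eq_expectation_card[OF assms(1,2)] by (simp add: prob_space)
qed

lemma open_edge_event:
  assumes "sets P = sets (config_space E)" "e \<in> E"
  shows "{\<omega> \<in> space P. \<omega> e = 1} \<in> sets P"
proof -
  have "(\<lambda>\<omega>. \<omega> e) \<in> measurable P (count_space {0, 1 :: nat})"
    unfolding measurable_cong_sets[OF assms(1) refl] config_space_def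
    using assms(2) by measurable
  then have "(\<lambda>\<omega>. \<omega> e) -` {1} \<inter> space P \<in> sets P"
    by (rule measurable_sets) simp
  moreover have "(\<lambda>\<omega>. \<omega> e) -` {1} \<inter> space P = {\<omega> \<in> space P. \<omega> e = 1}"
    by auto
  ultimately show ?thesis by simp
qed

section \<open>Pairs of open edges\<close>

lemma card_Int_adjacent_edges:
  assumes "card e = 2" "card f = 2" "adjacent_edges e f"
  shows "card (e \<inter> f) = 1"
proof -
  have fin: "finite e" "finite f"
    using assms(1,2) by (auto intro: card_ge_0_finite)
  \<comment> \<open>Otherwise \<open>e \<subseteq> f\<close>, and equal cardinalities would give
    \<open>e = f\<close>.\<close>
  have "e \<inter> f \<subset> e"
    using assms fin card_subset_eq[of f e] by (auto simp: adjacent_edges_def inf.absorb_iff1)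
  then have "card (e \<inter> f) < 2"
    using psubset_card_mono fin(1) assms(1) by metis
  moreover have "card (e \<inter> f) \<noteq> 0"
    using assms(3) fin by (auto simp: adjacent_edges_def)
  ultimately show ?thesis by simp
qed

theorem lemma2p1:
  fixes V :: "'v set" and E :: "'v set set" and P :: "('v set \<Rightarrow> nat) measure" and n :: nat
  assumes "finite V" and "simple_graph V E" and "connected_graph V E" and "n = card V"
    and "prob_space P" and "sets P = sets (config_space E)"
    and "aut_invariant V E P"
    and "AE \<omega> in P. tree_graph V (open_edges E \<omega>)"
  shows "(\<Sum>(e, f) \<in> {(e, f). e \<in> E \<and> f \<in> E \<and> adjacent_edges e f}.
             \<P>(\<omega> in P. \<omega> e = 1 \<and> \<omega> f = 1))
           = (\<Sum>x\<in>V. \<integral>\<omega>. (real (graph_degree (open_edges E \<omega>) x))\<^sup>2 \<partial>P) - 2 * (real n - 1)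
       \<and> (\<Sum>(e, f) \<in> {(e, f). e \<in> E \<and> f \<in> E \<and> nonadjacent_edges e f}.
             \<P>(\<omega> in P. \<omega> e = 1 \<and> \<omega> f = 1))
           = real n * (real n - 1)
             - (\<Sum>x\<in>V. \<integral>\<omega>. (real (graph_degree (open_edges E \<omega>) x))\<^sup>2 \<partial>P)"
proof -
  interpret prob_space P by fact
  note simple = assms(2)
  have finE: "finite E"
    using simple assms(1) by (auto simp: simple_graph_def intro: finite_subset[of _ "Pow V"])
  \<comment> \<open>This makes \<open>real (n - 1)\<close> equal to
    \<open>real n - 1\<close>.\<close>
  have n: "n \<ge> 1"
    using assms(1,3,4) by (simp add: connected_graph_def Suc_le_eq card_gt_0_iff)
  let ?pp = "\<lambda>(e, f). \<P>(\<omega> in P. \<omega> e = 1 \<and> \<omega> f = 1)"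
  let ?A = "{(e, f). e \<in> E \<and> f \<in> E \<and> adjacent_edges e f}"
  let ?N = "{(e, f). e \<in> E \<and> f \<in> E \<and> nonadjacent_edges e f}"
  let ?D = "(\<lambda>e. (e, e)) ` E"
  \<comment> \<open>The event behind \<open>?pp\<close>, indexed by a pair, so that the counting
    lemmas apply with pairs of edges as indices.\<close>
  let ?both = "\<lambda>(e, f) (\<omega> :: 'v set \<Rightarrow> nat). \<omega> e = 1 \<and> \<omega> f = 1"
  have event: "{\<omega> \<in> space P. \<omega> e = 1} \<in> events" if "e \<in> E" for e
    using open_edge_event assms(6) that by blast
  have event2: "{\<omega> \<in> space P. ?both s \<omega>} \<in> events" if "s \<in> E \<times> E" for s
  proof -
    have "{\<omega> \<in> space P. \<omega> (fst s) = 1} \<inter> {\<omega> \<in> space P. \<omega> (snd s) = 1} \<in> events"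
      using that by (intro sets.Int event) auto
    then show ?thesis
      by (simp add: case_prod_unfold Int_def conj_ac cong: conj_cong)
  qed
  have pp: "?pp s = \<P>(\<omega> in P. ?both s \<omega>)" for s
    by (simp add: case_prod_unfold)
  have AE_card: "AE \<omega> in P. card (open_edges E \<omega>) = n - 1"
    using assms(8) by eventually_elim (use tree_card_edges assms(1,4) in fastforce)

  have diag: "(\<Sum>s\<in>?D. ?pp s) = real n - 1"
  proof -
    have "(\<Sum>s\<in>?D. ?pp s) = (\<Sum>e\<in>E. \<P>(\<omega> in P. \<omega> e = 1))"
      by (subst sum.reindex) (auto simp: inj_on_def)
    also have "\<dots> = real (n - 1)"
      using AE_card by (intro sum_prob_eq_const finE event) (auto simp: open_edges_def)
    finally show ?thesis using n by simp
  qed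
  have total: "(\<Sum>s\<in>E \<times> E. ?pp s) = (real n - 1)\<^sup>2"
  proof -
    have "{s \<in> E \<times> E. ?both s \<omega>} = open_edges E \<omega> \<times> open_edges E \<omega>" for \<omega>
      by (auto simp: open_edges_def)
    then have "AE \<omega> in P. card {s \<in> E \<times> E. ?both s \<omega>} = (n - 1)\<^sup>2"
      using AE_card 
      by (simp only: card_cartesian_product power2_eq_square) (elim eventually_mono, simp)
    then have "(\<Sum>s\<in>E \<times> E. ?pp s) = real ((n - 1)\<^sup>2)"
      unfolding pp using finE event2 by (intro sum_prob_eq_const) auto
    then show ?thesis using n by simp
  qed
  \<comment> \<open>The squared degree counts ordered pairs of open edges at \<open>x\<close>, equal
    ones included. The weight \<open>of_bool\<close> keeps the index set independent of
    \<open>x\<close>, so that the sum over \<open>x\<close> can be moved inside.\<close>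
  have degree: "(\<integral>\<omega>. (real (graph_degree (open_edges E \<omega>) x))\<^sup>2 \<partial>P)
      = (\<Sum>s\<in>E \<times> E. of_bool (x \<in> fst s \<inter> snd s) * ?pp s)" for x
  proof -
    let ?S = "{s \<in> E \<times> E. x \<in> fst s \<inter> snd s}"
    have "{s \<in> ?S. ?both s \<omega>}
        = {e \<in> open_edges E \<omega>. x \<in> e} \<times> {e \<in> open_edges E \<omega>. x \<in> e}" for \<omega>
      by (auto simp: open_edges_def)
    then have "(real (graph_degree (open_edges E \<omega>) x))\<^sup>2 = real (card {s \<in> ?S. ?both s \<omega>})"
      for \<omega>
      by (simp only: card_cartesian_product graph_degree_def power2_eq_square of_nat_mult)
    then have "(\<integral>\<omega>. (real (graph_degree (open_edges E \<omega>) x))\<^sup>2 \<partial>P)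
        = (\<integral>\<omega>. real (card {s \<in> ?S. ?both s \<omega>}) \<partial>P)"
      by (simp only:)
    also have "\<dots> = (\<Sum>s\<in>?S. ?pp s)"
      unfolding pp using finE event2 by (intro sum_prob_eq_expectation_card[symmetric]) auto
    also have "\<dots> = (\<Sum>s\<in>E \<times> E. of_bool (x \<in> fst s \<inter> snd s) * ?pp s)"
      using finE by (intro sum.mono_neutral_cong_left) auto
    finally show ?thesis .
  qed
  \<comment> \<open>Stated for arbitrary \<open>g\<close>, since it serves both the sum weighted by
    \<open>card (fst s \<inter> snd s)\<close> and the unweighted one.\<close>
  have split: "(\<Sum>s\<in>E \<times> E. g s) = (\<Sum>s\<in>?D. g s) + (\<Sum>s\<in>?A. g s) + (\<Sum>s\<in>?N. g s)"
    for g :: "'v set \<times> 'v set \<Rightarrow> real"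
  proof -
    have "E \<times> E = ?D \<union> ?A \<union> ?N"
      by (auto simp: adjacent_edges_def nonadjacent_edges_def)
    moreover have "finite ?A" "finite ?N"
      by (auto intro: finite_subset[OF _ finite_cartesian_product[OF finE finE]])
    moreover have "?D \<inter> ?A = {}" "(?D \<union> ?A) \<inter> ?N = {}"
      by (auto simp: adjacent_edges_def nonadjacent_edges_def)
    ultimately show ?thesis
      using finE by (simp only: sum.union_disjoint finite_Un finite_imageI simp_thms)
  qed
  have "(\<Sum>x\<in>V. \<integral>\<omega>. (real (graph_degree (open_edges E \<omega>) x))\<^sup>2 \<partial>P)
      = (\<Sum>s\<in>E \<times> E. real (card (fst s \<inter> snd s)) * ?pp s)"
  proof -
    have "(\<Sum>x\<in>V. of_bool (x \<in> fst s \<inter> snd s)) = real (card (fst s \<inter> snd s))"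
      if "s \<in> E \<times> E" for s
    proof -
      \<comment> \<open>Edges lie inside \<open>V\<close>, so summing over \<open>V\<close> sees
        every common endpoint.\<close>
      have "V \<inter> {x. x \<in> fst s \<inter> snd s} = fst s \<inter> snd s"
        using that simple by (auto simp: simple_graph_def)
      then show ?thesis
        using assms(1) by (simp only: sum_of_bool_eq)
    qed
    then show ?thesis
      unfolding degree by (subst sum.swap) (simp flip: sum_distrib_right)
  qed
  also have "\<dots> = 2 * (\<Sum>s\<in>?D. ?pp s) + (\<Sum>s\<in>?A. ?pp s)"
  proof -
    have "(\<Sum>s\<in>?D. real (card (fst s \<inter> snd s)) * ?pp s) = (\<Sum>s\<in>?D. 2 * ?pp s)"
      using simple by (intro sum.cong) (auto simp: simple_graph_def)
    moreover have "(\<Sum>s\<in>?A. real (card (fst s \<inter> snd s)) * ?pp s) = (\<Sum>s\<in>?A. ?pp s)"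
      using simple
      by (intro sum.cong) (auto simp: card_Int_adjacent_edges[unfolded One_nat_def] simple_graph_def)
    moreover have "(\<Sum>s\<in>?N. real (card (fst s \<inter> snd s)) * ?pp s) = 0"
      by (intro sum.neutral) (auto simp: nonadjacent_edges_def)
    ultimately show ?thesis
      by (simp only: split sum_distrib_left add_0_right)
  qed
  finally have deg_sum: "(\<Sum>x\<in>V. \<integral>\<omega>. (real (graph_degree (open_edges E \<omega>) x))\<^sup>2 \<partial>P)
      = 2 * (real n - 1) + (\<Sum>s\<in>?A. ?pp s)"
    unfolding diag .
  \<comment> \<open>Eliminating the adjacent sum through \<open>deg_sum\<close> leaves the constant
    \<open>(n - 1)^2 - (n - 1) + 2 * (n - 1) = n * (n - 1)\<close> for the non-adjacent sum.\<close>
  moreover have "(real n - 1)\<^sup>2 = (real n - 1) + (\<Sum>s\<in>?A. ?pp s) + (\<Sum>s\<in>?N. ?pp s)"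
    using split[of ?pp] unfolding total diag .
  ultimately show ?thesis
    by (simp add: power2_eq_square algebra_simps)
qed

end
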